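(* Let $F=(F_1,\dots,F_N):\mathbb{T}^N\to\mathbb{R}^N$ be a $C^2$ vector field. If there exist distinct indices $i,j,k$ and a point $\theta^*\in\mathbb{T}^N$ such that $\partial_{\theta_j}\partial_{\theta_k}F_i(\theta^* )\neq0$, then $F\notin\mathcal{V}_{\mathrm{pair}}$.
   Context: $\mathbb{T}=\mathbb{R}/2\pi\mathbb{Z}$. Pairwise class: a $C^2$ vector field $F=(F_1,\dots,F_N):\mathbb{T}^N\to\mathbb{R}^N$ is pairwise, written $F\in\mathcal{V}_{\mathrm{pair}}$, if for each $i\in\{1,\dots,N\}$ there exist functions $G_{ij}\in C^2(\mathbb{T}^2,\mathbb{R})$, $j=1,\dots,N$, with $F_i(\theta)=\sum_{j=1}^N G_{ij}(\theta_i,\theta_j)$ for all $\theta\in\mathbb{T}^N$. *)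

theory Defs
  imports "HOL-Analysis.Analysis"
begin

quotient_type circle = real / "\<lambda>x y. \<exists>k::int. x - y = 2 * pi * of_int k"
  morphisms circle_rep to_circle
proof (rule equivpI)
  show "reflp (\<lambda>x y. \<exists>k::int. x - y = 2 * pi * of_int k)"
    by (rule reflpI, rule exI[of _ 0]) simp
  show "symp (\<lambda>x y. \<exists>k::int. x - y = 2 * pi * of_int k)"
  proof (rule sympI, elim exE)
    fix x y :: real and k :: int
    assume "x - y = 2 * pi * of_int k"
    then show "\<exists>k::int. y - x = 2 * pi * of_int k"
      by (intro exI[of _ "- k"]) simp
  qed
  show "transp (\<lambda>x y. \<exists>k::int. x - y = 2 * pi * of_int k)"
  proof (rule transpI, elim exE)
    fix x y z :: real and k l :: int
    assume "x - y = 2 * pi * of_int k" "y - z = 2 * pi * of_int l"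
    then show "\<exists>k::int. x - z = 2 * pi * of_int k"
      by (intro exI[of _ "k + l"]) (simp add: algebra_simps)
  qed
qed

instantiation circle :: ab_group_add
begin

lift_definition zero_circle :: circle is 0 .

lift_definition plus_circle :: "circle \<Rightarrow> circle \<Rightarrow> circle" is "(+)"
proof (elim exE)
  fix a b c d :: real and k l :: int
  assume "a - b = 2 * pi * of_int k" "c - d = 2 * pi * of_int l"
  then show "\<exists>m::int. (a + c) - (b + d) = 2 * pi * of_int m"
    by (intro exI[of _ "k + l"]) (simp add: algebra_simps)
qed

lift_definition uminus_circle :: "circle \<Rightarrow> circle" is uminus
proof (elim exE)
  fix a b :: real and k :: int
  assume "a - b = 2 * pi * of_int k"
  then show "\<exists>m::int. - a - - b = 2 * pi * of_int m"
    by (intro exI[of _ "- k"]) simp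
qed

definition minus_circle :: "circle \<Rightarrow> circle \<Rightarrow> circle" where
  "minus_circle a b = a + - b"

instance
proof
  fix a b c :: circle
  show "a + b + c = a + (b + c)"
    by transfer (rule exI[of _ 0], simp)
  show "a + b = b + a"
    by transfer (rule exI[of _ 0], simp)
  show "0 + a = a"
    by transfer (rule exI[of _ 0], simp)
  show "- a + a = 0"
    by transfer (rule exI[of _ 0], simp)
  show "a - b = a + - b"
    by (rule minus_circle_def)
qed

end

definition to_torus :: "real^'n \<Rightarrow> circle^'n" where
  "to_torus x = (\<chi> i. to_circle (x $ i))"

lemma to_circle_add: "to_circle (x + y) = to_circle x + to_circle y"
  by (simp add: plus_circle.abs_eq)

lemma to_circle_zero: "to_circle 0 = 0"
  by (simp add: zero_circle_def)

lemma to_torus_add_axis: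
  "to_torus (x + axis k t) = to_torus x + axis k (to_circle t)"
  by (simp add: to_torus_def axis_def vec_eq_iff to_circle_add to_circle_zero)

definition C2 :: "('a::real_normed_vector \<Rightarrow> 'b::real_normed_vector) \<Rightarrow> bool" where
  "C2 f \<longleftrightarrow>
    (\<exists>(f' :: 'a \<Rightarrow> 'a \<Rightarrow>\<^sub>L 'b) (f'' :: 'a \<Rightarrow> 'a \<Rightarrow>\<^sub>L 'a \<Rightarrow>\<^sub>L 'b).
      (\<forall>x. (f has_derivative blinfun_apply (f' x)) (at x)) \<and>
      (\<forall>x. (f' has_derivative blinfun_apply (f'' x)) (at x)) \<and>
      continuous_on UNIV f'')"

text \<open>The covering map \<^const>\<open>to_torus\<close> is a local diffeomorphism, so a function on the torus is
  twice continuously differentiable iff its periodic lift to Euclidean space is.\<close>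

definition C2_torus :: "(circle^'n \<Rightarrow> 'b::real_normed_vector) \<Rightarrow> bool" where
  "C2_torus f \<longleftrightarrow> C2 (f \<circ> to_torus)"

text \<open>The partial derivative is taken along the curve \<open>\<theta> + t e\<^sub>k\<close> (modulo \<open>2\<pi>\<close>), which
  needs no choice of a representative of \<open>\<theta>\<close>.\<close>

definition partial_torus :: "'n \<Rightarrow> (circle^'n \<Rightarrow> real) \<Rightarrow> circle^'n \<Rightarrow> real" where
  "partial_torus k f \<theta> = deriv (\<lambda>t. f (\<theta> + axis k (to_circle t))) 0"

lemma partial_torus_to_torus:
  "partial_torus k f (to_torus x) = deriv (\<lambda>t. (f \<circ> to_torus) (x + axis k t)) 0"
  by (simp add: partial_torus_def to_torus_add_axis)

definition pairwise_fields :: "(circle^'n \<Rightarrow> real^'n) set" where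
  "pairwise_fields =
    {F. C2_torus F \<and>
        (\<forall>i. \<exists>G :: 'n \<Rightarrow> circle^2 \<Rightarrow> real.
          (\<forall>j. C2_torus (G j)) \<and>
          (\<forall>\<theta>. F \<theta> $ i = (\<Sum>j\<in>UNIV. G j (vector [\<theta> $ i, \<theta> $ j]))))}"

end

theory Submission
  imports Defs
begin

text \<open>Moving \<open>\<theta>\<^sub>k\<close> affects only the summand \<open>G\<^sub>i\<^sub>k(\<theta>\<^sub>i, \<theta>\<^sub>k)\<close> of a pairwise field, so \<open>\<partial>\<^sub>kF\<^sub>i\<close> depends on
  \<open>\<theta>\<^sub>i\<close> and \<open>\<theta>\<^sub>k\<close> alone and is annihilated by \<open>\<partial>\<^sub>j\<close>.\<close>

text \<open>\<open>deriv\<close> picks a value by the predicate \<open>has_field_derivative\<close>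
  alone, and adding a constant leaves that predicate unchanged, so differentiability of
  \<open>f\<close> does not enter.\<close>

lemma deriv_add_const:
  fixes f :: "'a::real_normed_field \<Rightarrow> 'a"
  shows "deriv (\<lambda>t. f t + c) x = deriv f x"
proof -
  have "((\<lambda>t. f t + c) has_field_derivative D) (at x) \<longleftrightarrow> (f has_field_derivative D) (at x)" for D
    \<comment> \<open>Adding \<open>- c\<close> to \<open>f t + c\<close> recovers \<open>f\<close>,
      which gives the converse.\<close>
    using DERIV_add[OF _ DERIV_const, of f D x UNIV c]
      DERIV_add[OF _ DERIV_const, of "\<lambda>t. f t + c" D x UNIV "- c"]
    by auto
  then show ?thesis
    by (simp add: deriv_def)
qed

lemma partial_torus_pairwise_sum:
  fixes G :: "'n::finite \<Rightarrow> circle^2 \<Rightarrow> real" and \<theta> :: "circle^'n"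
  assumes "i \<noteq> k"
  shows "partial_torus k (\<lambda>\<theta>. \<Sum>m\<in>UNIV. G m (vector [\<theta> $ i, \<theta> $ m])) \<theta> =
    deriv (\<lambda>t. G k (vector [\<theta> $ i, \<theta> $ k + to_circle t])) 0"
proof -
  have "(\<Sum>m\<in>UNIV. G m (vector [(\<theta> + axis k c) $ i, (\<theta> + axis k c) $ m])) =
      G k (vector [\<theta> $ i, \<theta> $ k + c]) + (\<Sum>m\<in>UNIV - {k}. G m (vector [\<theta> $ i, \<theta> $ m]))" for c
    using assms by (subst sum.remove[of _ k]) (auto simp: axis_def intro!: sum.cong)
  then show ?thesis
    by (simp add: partial_torus_def deriv_add_const)
qed

theorem corollary2p7:
  fixes F :: "circle^'n \<Rightarrow> real^'n"
  assumes "C2_torus F"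
    and "\<exists>i j k \<theta>. i \<noteq> j \<and> i \<noteq> k \<and> j \<noteq> k \<and>
           partial_torus j (partial_torus k (\<lambda>\<theta>. F \<theta> $ i)) \<theta> \<noteq> 0"
  shows "F \<notin> pairwise_fields"
proof
  assume "F \<in> pairwise_fields"
  obtain i j k \<theta> where ij: "i \<noteq> j" and ik: "i \<noteq> k" and jk: "j \<noteq> k"
    and nz: "partial_torus j (partial_torus k (\<lambda>\<theta>. F \<theta> $ i)) \<theta> \<noteq> 0"
    using assms(2) by blast
  obtain G :: "'n \<Rightarrow> circle^2 \<Rightarrow> real"
    where G: "\<And>\<theta>. F \<theta> $ i = (\<Sum>m\<in>UNIV. G m (vector [\<theta> $ i, \<theta> $ m]))"
    using \<open>F \<in> pairwise_fields\<close> unfolding pairwise_fields_def by blast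
  \<comment> \<open>As \<open>j\<close> differs from \<open>i\<close> and \<open>k\<close>, the
    shift by \<open>c\<close> changes neither coordinate on the right.\<close>
  have "partial_torus k (\<lambda>\<theta>. F \<theta> $ i) (\<theta> + axis j c) =
      deriv (\<lambda>t. G k (vector [\<theta> $ i, \<theta> $ k + to_circle t])) 0" for c
    using ij jk by (simp add: G partial_torus_pairwise_sum[OF ik] axis_def)
  \<comment> \<open>Only the outer partial is unfolded, so the inner one still matches the previous
    equation; what remains is the derivative of a constant.\<close>
  then have "partial_torus j (partial_torus k (\<lambda>\<theta>. F \<theta> $ i)) \<theta> = 0"
    by (simp add: partial_torus_def[of j])
  with nz show False
    by contradiction
qed

end
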